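(* For all $N\geq 2$, the function $$I_{(N)} = \sum_{i\neq j} \Big( \operatorname{sgn}(x_{ij})\, (-1)^{s_j + s_i}\, a_j^2\, x_i + \tfrac{3}{2}\, a_i a_j e^{-|x_{ij}|} \Big)$$ is a permutation-invariant local constant of motion of the mCH $N$-peakon dynamical system $$\dot a_i = 0,\qquad \dot x_i = \tfrac{2}{3} a_i^2 + 2 a_i \sum_{j \neq i} a_j e^{-|x_{ij}|} + 2\sum_{\substack{j <k\\ j,k \neq i}} a_j a_k \big(1-\operatorname{sgn}(x_{ij}) \operatorname{sgn}(x_{ik})\big)e^{-|x_{ij}|-|x_{ik}|},\qquad i=1,\ldots,N.$$ Moreover, for all odd $N\geq 3$, $I_{(N)}$ is also invariant under position shifts $x_i\to x_i+\epsilon$, $i=1,\ldots,N$ (with $\epsilon$ an arbitrary real constant). When the system is expressed in position-ordered form, i.e. with $x_1>x_2>\cdots>x_N$, where it reads $$\dot a_i = 0,\qquad \dot x_i = \tfrac{2}{3} a_i^2 + 2 a_i \sum_{j \neq i} a_j e^{-|x_{ij}|} + 4\sum_{j <i<k} a_j a_k e^{-x_{jk}},$$ this constant of motion is given, for all $N\geq 2$, by $$I_{(N)} = \sum_{i<j} \Big( 3 a_i a_j e^{-x_{ij}} + (-1)^{i+j} (a_j^2 x_i - a_i^2 x_j) \Big),$$ and, when $N$ is odd, by $$I_{(N)} = \sum_{i<j} 3 a_i a_j e^{-x_{ij}} - \sum_{i\text{ even}}\Big( x_{i-1,\,i}\sum_{j\geq i} (-1)^{j} a_j^2 + x_{i,\,i+1}\sum_{j\leq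 i} (-1)^{j} a_j^2 \Big).$$
   Context: The dynamical variables are real functions $a_i(t)$ (amplitudes) and $x_i(t)$ (positions), $i=1,\ldots,N$, and $x_{ij}=x_i-x_j$. All summation indices run from $1$ to $N$. Here $\operatorname{sgn}(x)=\pm1$ for $\pm x>0$ and $\operatorname{sgn}(0)=0$. The integer $s_k$ denotes the number of signs that are equal to $+1$ in the list $(\operatorname{sgn}(x_{1k}),\ldots,\operatorname{sgn}(x_{Nk}))$; thus $s_k$ is the number of indices $j$ with $x_j>x_k$. A local constant of motion is a function $I(a_1,\ldots,a_N,x_1,\ldots,x_N)$, with no explicit dependence on $t$, that satisfies $\dot I=0$ along solutions of the dynamical system at all times $t$ at which the positions are distinct ($x_{ij}\neq 0$ for all $i\neq j$); it may have jump discontinuities at collision times. Permutation-invariant means invariant under all permutations of the set of pairs $(a_i,x_i)$, $i=1,\ldots,N$. This system governs $N$-peakon weak solutions $u(x,t)=\sum_{i=1}^N a_i(t)e^{-|x-x_i(t)|}$ of the modified Camassa-Holm (mCH) equation $m_t+((u^2-u_x^2)m)_x=0$, $m=u-u_{xx}$.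
   Formalization: Invariance under position shifts for odd N is stated only for distinct positions; with sgn(0)=0 it fails at coincident ones: for N=3, x_1=x_2>x_3, a shift by ε changes I by ε(2a_3²−a_1²−a_2²). *)

theory Defs
  imports "HOL-Analysis.Analysis" "HOL-Combinatorics.Permutations"
begin

text \<open>
  A configuration of \<open>N\<close> peakons consists of amplitudes and positions \<open>a, x :: nat \<Rightarrow> real\<close>, of which
  only the values at the indices \<open>1, \<dots>, N\<close> are relevant. A trajectory \<open>a, x :: nat \<Rightarrow> real \<Rightarrow> real\<close>
  takes the index first and the time second.
\<close>

definition peakon_velocity :: "nat \<Rightarrow> (nat \<Rightarrow> real) \<Rightarrow> (nat \<Rightarrow> real) \<Rightarrow> nat \<Rightarrow> real" where
  "peakon_velocity N a x i =
     2/3 * (a i)\<^sup>2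
     + 2 * a i * (\<Sum>j\<in>{1..N} - {i}. a j * exp (- \<bar>x i - x j\<bar>))
     + 2 * (\<Sum>(j, k)\<in>{(j, k). j \<in> {1..N} - {i} \<and> k \<in> {1..N} - {i} \<and> j < k}.
              a j * a k * (1 - sgn (x i - x j) * sgn (x i - x k))
              * exp (- \<bar>x i - x j\<bar> - \<bar>x i - x k\<bar>))"

definition position_ordered :: "nat \<Rightarrow> (nat \<Rightarrow> real) \<Rightarrow> bool" where
  "position_ordered N x \<longleftrightarrow> (\<forall>i\<in>{1..N}. \<forall>j\<in>{1..N}. i < j \<longrightarrow> x i > x j)"

definition ordered_peakon_velocity :: "nat \<Rightarrow> (nat \<Rightarrow> real) \<Rightarrow> (nat \<Rightarrow> real) \<Rightarrow> nat \<Rightarrow> real" where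
  "ordered_peakon_velocity N a x i =
     2/3 * (a i)\<^sup>2
     + 2 * a i * (\<Sum>j\<in>{1..N} - {i}. a j * exp (- \<bar>x i - x j\<bar>))
     + 4 * (\<Sum>(j, k)\<in>{(j, k). j \<in> {1..N} \<and> k \<in> {1..N} \<and> j < i \<and> i < k}.
              a j * a k * exp (- (x j - x k)))"

text \<open>
  Nothing is required of a solution at collision times, where the velocities are discontinuous
  functions of the positions. In particular, every trajectory that satisfies the equations at all
  times in \<open>T\<close> (with \<open>sgn 0 = 0\<close>) is a solution.
\<close>

definition peakon_solution ::
    "nat \<Rightarrow> real set \<Rightarrow> (nat \<Rightarrow> real \<Rightarrow> real) \<Rightarrow> (nat \<Rightarrow> real \<Rightarrow> real) \<Rightarrow> bool" where
  "peakon_solution N T a x \<longleftrightarrow>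
     is_interval T \<and>
     (\<forall>t\<in>T. inj_on (\<lambda>i. x i t) {1..N} \<longrightarrow>
        (\<forall>i\<in>{1..N}.
           (a i has_real_derivative 0) (at t within T) \<and>
           (x i has_real_derivative peakon_velocity N (\<lambda>j. a j t) (\<lambda>j. x j t) i) (at t within T)))"

definition local_constant_of_motion ::
    "nat \<Rightarrow> ((nat \<Rightarrow> real) \<Rightarrow> (nat \<Rightarrow> real) \<Rightarrow> real) \<Rightarrow> bool" where
  "local_constant_of_motion N I \<longleftrightarrow>
     (\<forall>T a x. peakon_solution N T a x \<longrightarrow>
        (\<forall>t\<in>T. inj_on (\<lambda>i. x i t) {1..N} \<longrightarrow>
           ((\<lambda>\<tau>. I (\<lambda>i. a i \<tau>) (\<lambda>i. x i \<tau>)) has_real_derivative 0) (at t within T)))"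

definition permutation_invariant ::
    "nat \<Rightarrow> ((nat \<Rightarrow> real) \<Rightarrow> (nat \<Rightarrow> real) \<Rightarrow> real) \<Rightarrow> bool" where
  "permutation_invariant N I \<longleftrightarrow>
     (\<forall>p a x. p permutes {1..N} \<longrightarrow> I (a \<circ> p) (x \<circ> p) = I a x)"

definition sign_count :: "nat \<Rightarrow> (nat \<Rightarrow> real) \<Rightarrow> nat \<Rightarrow> nat" where
  "sign_count N x k = card {j \<in> {1..N}. sgn (x j - x k) = 1}"

definition I_peakon :: "nat \<Rightarrow> (nat \<Rightarrow> real) \<Rightarrow> (nat \<Rightarrow> real) \<Rightarrow> real" where
  "I_peakon N a x =
     (\<Sum>(i, j)\<in>{(i, j). i \<in> {1..N} \<and> j \<in> {1..N} \<and> i \<noteq> j}.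
        sgn (x i - x j) * (-1) ^ (sign_count N x j + sign_count N x i) * (a j)\<^sup>2 * x i
        + 3/2 * a i * a j * exp (- \<bar>x i - x j\<bar>))"

text \<open>
  The restriction to distinct positions is essential: for three peakons with
  \<open>x 1 = x 2 > x 3\<close>, a shift by \<open>\<epsilon>\<close> changes the value of \<open>I_peakon 3 a x\<close> by \<open>\<epsilon> (2 (a 3)\<^sup>2 - (a 1)\<^sup>2 - (a 2)\<^sup>2)\<close>.
\<close>

definition shift_invariant ::
    "nat \<Rightarrow> ((nat \<Rightarrow> real) \<Rightarrow> (nat \<Rightarrow> real) \<Rightarrow> real) \<Rightarrow> bool" where
  "shift_invariant N I \<longleftrightarrow>
     (\<forall>a x \<epsilon>. inj_on x {1..N} \<longrightarrow> I a (\<lambda>i. x i + \<epsilon>) = I a x)"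

end

theory Submission
  imports Defs
begin

text \<open>
  Relabelling the peakons, one may assume \<open>x 1 > \<dots> > x N\<close>. Let \<open>P i\<close> and \<open>Q i\<close> be the sums of
  \<open>a j * exp (- \<bar>x i - x j\<bar>)\<close> over \<open>j < i\<close> and \<open>j > i\<close>, and put \<open>W i = (P i + a i) * Q i\<close>.
  Both \<open>P (i + 1) = r * (P i + a i)\<close> and \<open>Q i = r * (Q (i + 1) + a (i + 1))\<close> hold with the same
  factor \<open>r = exp (x (i + 1) - x i)\<close>, so that \<open>W (i - 1) = P i * (Q i + a i)\<close>.
  Hence the velocity of the \<open>i\<close>-th peakon is
  \<open>2/3 * (a i)\<^sup>2 + 2 * W i + 2 * W (i - 1)\<close>, and the time derivative of the
  conserved quantity becomes a telescoping sum whose boundary terms contain \<open>W 0 = W N = 0\<close>.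
\<close>

section \<open>Sums over pairs of indices\<close>

text \<open>The off-diagonal pairs are the upper triangle together with its mirror image under
  \<open>prod.swap\<close>. This folds the sum in \<open>I_peakon\<close> into one term per
  unordered pair.\<close>

lemma sum_neq_pairs:
  fixes h :: "'a::linorder \<Rightarrow> 'a \<Rightarrow> 'b::comm_monoid_add"
  assumes "finite A"
  shows "(\<Sum>(i, j)\<in>{(i, j). i \<in> A \<and> j \<in> A \<and> i \<noteq> j}. h i j)
       = (\<Sum>(i, j)\<in>{(i, j). i \<in> A \<and> j \<in> A \<and> i < j}. h i j + h j i)"
proof -
  let ?L = "{(i, j). i \<in> A \<and> j \<in> A \<and> i < j}"
  have fin: "finite ?L"
    by (rule finite_subset[of _ "A \<times> A"]) (use assms in auto)
  have split: "{(i, j). i \<in> A \<and> j \<in> A \<and> i \<noteq> j} = ?L \<union> prod.swap ` ?L"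
    by (auto simp: image_iff)
  have "(\<Sum>(i, j)\<in>prod.swap ` ?L. h i j) = (\<Sum>(i, j)\<in>?L. h j i)"
    by (subst sum.reindex) (auto intro!: sum.cong)
  moreover have "?L \<inter> prod.swap ` ?L = {}"
    by auto
  ultimately show ?thesis
    unfolding split by (subst sum.union_disjoint) (use fin in \<open>auto simp: sum.distrib case_prod_unfold\<close>)
qed

text \<open>Lets the factor 2 in front of the triangular sum in \<open>peakon_velocity\<close> be
  absorbed: the full square of indices is reached, where the double sum can factor.\<close>

lemma sum_sym_pairs:
  fixes h :: "'a::linorder \<Rightarrow> 'a \<Rightarrow> real"
  assumes "finite A" and "\<And>i j. h i j = h j i" and "\<And>i. i \<in> A \<Longrightarrow> h i i = 0"
  shows "2 * (\<Sum>(i, j)\<in>{(i, j). i \<in> A \<and> j \<in> A \<and> i < j}. h i j) = (\<Sum>i\<in>A. \<Sum>j\<in>A. h i j)"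
proof -
  have "(\<Sum>i\<in>A. \<Sum>j\<in>A. h i j) = (\<Sum>(i, j)\<in>A \<times> A. h i j)"
    by (simp add: sum.cartesian_product)
  also have "\<dots> = (\<Sum>(i, j)\<in>{(i, j). i \<in> A \<and> j \<in> A \<and> i \<noteq> j}. h i j)"
    by (rule sum.mono_neutral_right) (use assms in auto)
  also have "\<dots> = (\<Sum>(i, j)\<in>{(i, j). i \<in> A \<and> j \<in> A \<and> i < j}. h i j + h j i)"
    by (rule sum_neq_pairs) fact
  also have "\<dots> = 2 * (\<Sum>(i, j)\<in>{(i, j). i \<in> A \<and> j \<in> A \<and> i < j}. h i j)"
    unfolding sum_distrib_left by (rule sum.cong) (auto simp: assms(2))
  finally show ?thesis ..
qed

lemma sum_less_pairs_fst:
  fixes h :: "nat \<Rightarrow> nat \<Rightarrow> 'b::comm_monoid_add"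
  shows "(\<Sum>(i, j)\<in>{(i, j). i \<in> {1..N} \<and> j \<in> {1..N} \<and> i < j}. h i j)
       = (\<Sum>i\<in>{1..N}. \<Sum>j\<in>{i<..N}. h i j)"
proof -
  have "{(i, j). i \<in> {1..N} \<and> j \<in> {1..N} \<and> i < j} = (SIGMA i:{1..N}. {i<..N})"
    by auto
  then show ?thesis
    by (simp add: sum.Sigma)
qed

lemma sum_less_pairs_snd:
  fixes h :: "nat \<Rightarrow> nat \<Rightarrow> 'b::comm_monoid_add"
  shows "(\<Sum>(i, j)\<in>{(i, j). i \<in> {1..N} \<and> j \<in> {1..N} \<and> i < j}. h i j)
       = (\<Sum>i\<in>{1..N}. \<Sum>j\<in>{1..<i}. h j i)"
proof -
  have "(\<Sum>i\<in>{1..N}. \<Sum>j\<in>{i<..N}. h i j) = (\<Sum>i\<in>{1..N}. \<Sum>j\<in>{j \<in> {1..N}. i < j}. h i j)"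
    by (intro sum.cong refl) auto
  also have "\<dots> = (\<Sum>j\<in>{1..N}. \<Sum>i\<in>{i \<in> {1..N}. i < j}. h i j)"
    by (rule sum.swap_restrict) auto
  also have "\<dots> = (\<Sum>j\<in>{1..N}. \<Sum>i\<in>{1..<j}. h i j)"
    by (intro sum.cong refl) auto
  finally show ?thesis
    by (simp only: sum_less_pairs_fst)
qed

lemma sum_remove_split:
  fixes f :: "nat \<Rightarrow> 'b::comm_monoid_add"
  assumes "i \<in> {1..N}"
  shows "(\<Sum>j\<in>{1..N} - {i}. f j) = (\<Sum>j\<in>{1..<i}. f j) + (\<Sum>j\<in>{i<..N}. f j)"
proof -
  have "{1..N} - {i} = {1..<i} \<union> {i<..N}"
    using assms by auto
  then have "(\<Sum>j\<in>{1..N} - {i}. f j) = (\<Sum>j\<in>{1..<i} \<union> {i<..N}. f j)"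
    by (simp only:)
  also have "\<dots> = (\<Sum>j\<in>{1..<i}. f j) + (\<Sum>j\<in>{i<..N}. f j)"
    by (rule sum.union_disjoint) auto
  finally show ?thesis .
qed

section \<open>Relabelling\<close>

text \<open>With the factor \<open>1 - sgn (x i - x j) * sgn (x i - x k)\<close>, the full double
  sum splits into the square of a plain sum minus the square of a signed one. The label-dependent
  condition \<open>j < k\<close> disappears, so relabelling becomes a mere reindexing.\<close>

lemma peakon_velocity_squares:
  assumes "inj_on x {1..N}" and "i \<in> {1..N}"
  shows "peakon_velocity N a x i =
     2/3 * (a i)\<^sup>2 + 2 * a i * (\<Sum>j\<in>{1..N} - {i}. a j * exp (- \<bar>x i - x j\<bar>))
     + (\<Sum>j\<in>{1..N} - {i}. a j * exp (- \<bar>x i - x j\<bar>))\<^sup>2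
     - (\<Sum>j\<in>{1..N} - {i}. sgn (x i - x j) * a j * exp (- \<bar>x i - x j\<bar>))\<^sup>2"
proof -
  let ?A = "{1..N} - {i}"
  define h where "h j k = a j * a k * (1 - sgn (x i - x j) * sgn (x i - x k))
      * exp (- \<bar>x i - x j\<bar> - \<bar>x i - x k\<bar>)" for j k
  \<comment> \<open>Distinctness enters here: the squared sign is 1. At a collision the diagonal
    term would be \<open>(a j)\<^sup>2\<close> instead.\<close>
  have "h j j = 0" if "j \<in> ?A" for j
  proof -
    have "x i \<noteq> x j"
      using assms that by (auto dest: inj_onD)
    then show ?thesis
      by (auto simp: h_def sgn_if)
  qed
  then have "2 * (\<Sum>(j, k)\<in>{(j, k). j \<in> ?A \<and> k \<in> ?A \<and> j < k}. h j k) = (\<Sum>j\<in>?A. \<Sum>k\<in>?A. h j k)"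
    by (intro sum_sym_pairs) (auto simp: h_def add.commute mult.commute diff_commute)
  also have "\<dots> = (\<Sum>j\<in>?A. a j * exp (- \<bar>x i - x j\<bar>))\<^sup>2
      - (\<Sum>j\<in>?A. sgn (x i - x j) * a j * exp (- \<bar>x i - x j\<bar>))\<^sup>2"
    unfolding power2_eq_square sum_product sum_subtractf[symmetric]
    by (intro sum.cong refl) (simp add: h_def exp_diff exp_minus field_simps)
  finally show ?thesis
    by (simp add: peakon_velocity_def h_def)
qed

text \<open>A permutation does not preserve the set of pairs \<open>j < k\<close>, but it does carry
  the two single sums of \<open>peakon_velocity_squares\<close> into each other.\<close>

lemma peakon_velocity_permute:
  assumes "p permutes {1..N}" and "inj_on x {1..N}" and "i \<in> {1..N}"
  shows "peakon_velocity N (a \<circ> p) (x \<circ> p) i = peakon_velocity N a x (p i)"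
proof -
  have inj: "inj_on (x \<circ> p) {1..N}"
    using assms by (intro comp_inj_on) (auto simp: permutes_inj_on permutes_image)
  have pi: "p i \<in> {1..N}"
    using assms(1,3) by (simp only: permutes_in_image)
  have bij: "bij_betw p ({1..N} - {i}) ({1..N} - {p i})"
    using permutes_inj_on[OF assms(1)] image_set_diff[OF permutes_inj[OF assms(1)], of "{1..N}" "{i}"]
      permutes_image[OF assms(1)]
    by (simp only: bij_betw_def image_insert image_empty)
  have "(\<Sum>j\<in>{1..N} - {i}. g (p j)) = (\<Sum>j\<in>{1..N} - {p i}. g j)" for g :: "nat \<Rightarrow> real"
    by (rule sum.reindex_bij_betw[OF bij])
  from this[of "\<lambda>j. a j * exp (- \<bar>x (p i) - x j\<bar>)"]
    this[of "\<lambda>j. sgn (x (p i) - x j) * a j * exp (- \<bar>x (p i) - x j\<bar>)"]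
  show ?thesis
    by (simp only: peakon_velocity_squares[OF inj assms(3)] peakon_velocity_squares[OF assms(2) pi]
        o_apply)
qed

lemma sign_count_permute:
  assumes "p permutes {1..N}"
  shows "sign_count N (x \<circ> p) k = sign_count N x (p k)"
proof -
  have "bij_betw p {j \<in> {1..N}. sgn (x (p j) - x (p k)) = 1} {j \<in> {1..N}. sgn (x j - x (p k)) = 1}"
    by (rule bij_betw_byWitness[where f' = "inv p"])
      (use assms in \<open>auto simp: permutes_inverses permutes_in_image permutes_inv
        simp del: atLeastAtMost_iff\<close>)
  then show ?thesis
    by (simp add: sign_count_def bij_betw_same_card)
qed

lemma permutation_invariant_I_peakon: "permutation_invariant N (I_peakon N)"
  unfolding permutation_invariant_def
proof (intro allI impI)
  fix p :: "nat \<Rightarrow> nat" and a x :: "nat \<Rightarrow> real"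
  assume p: "p permutes {1..N}"
  have inj: "p i = p j \<longleftrightarrow> i = j" for i j
    using p permutes_inj[OF p] by (auto dest: injD)
  show "I_peakon N (a \<circ> p) (x \<circ> p) = I_peakon N a x"
    unfolding I_peakon_def sign_count_permute[OF p]
    \<comment> \<open>The sum runs over all ordered pairs of distinct indices, a set which
      \<open>map_prod p p\<close> maps onto itself.\<close>
    by (rule sum.reindex_bij_witness[where i = "map_prod (inv p) (inv p)" and j = "map_prod p p"])
      (use p in \<open>auto simp: permutes_inverses permutes_in_image permutes_inv inj
        permutes_inv_eq simp del: atLeastAtMost_iff\<close>)
qed

section \<open>Sorting the positions\<close>

text \<open>Sending each peakon to its rank, counted from the front, is a permutation when the
  positions are distinct; its inverse lists the peakons in decreasing order of position.\<close>

lemma ex_ordering_permutation: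
  assumes "inj_on x {1..N}"
  obtains p where "p permutes {1..N}" and "position_ordered N (x \<circ> p)"
proof -
  let ?S = "\<lambda>k. {j \<in> {1..N}. sgn (x j - x k) = 1}"
  have less: "sign_count N x j < sign_count N x k"
    if "j \<in> {1..N}" "k \<in> {1..N}" "x k < x j" for j k
    unfolding sign_count_def
  \<comment> \<open>Whatever lies ahead of \<open>j\<close> lies ahead of \<open>k\<close>;
    strictness comes from \<open>j\<close> itself, which is ahead of \<open>k\<close> but not of
    itself.\<close>
  proof (rule psubset_card_mono)
    have "?S j \<subseteq> ?S k"
      using that by (auto simp: sgn_if split: if_splits)
    moreover have "j \<in> ?S k" "j \<notin> ?S j"
      using that by auto
    ultimately show "?S j \<subset> ?S k"
      by blast
  qed simp
  \<comment> \<open>\<open>Suc\<close> because the front peakon has count 0 but must get label 1;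
    outside the range \<open>q\<close> is the identity, as \<open>permutes\<close> demands.\<close>
  define q where "q k = (if k \<in> {1..N} then Suc (sign_count N x k) else k)" for k
  have q_less: "q j < q k" if "j \<in> {1..N}" "k \<in> {1..N}" "x k < x j" for j k
    using less that by (simp add: q_def)
  have "sign_count N x k < N" if "k \<in> {1..N}" for k
  proof -
    have "k \<notin> ?S k"
      by simp
    with that have "?S k \<subset> {1..N}"
      by blast
    from psubset_card_mono[OF _ this] show ?thesis
      by (simp add: sign_count_def)
  qed
  then have "q ` {1..N} \<subseteq> {1..N}"
    by (auto simp: q_def Suc_le_eq)
  moreover have "inj_on q {1..N}"
  proof (rule inj_onI)
    fix j k assume "j \<in> {1..N}" "k \<in> {1..N}" "q j = q k"
    then have "x j = x k"
      using q_less by (metis less_irrefl linorder_neqE_linordered_idom)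
    with assms \<open>j \<in> {1..N}\<close> \<open>k \<in> {1..N}\<close> show "j = k"
      by (auto dest: inj_onD)
  qed
  ultimately have "bij_betw q {1..N} {1..N}"
    by (simp add: bij_betw_def endo_inj_surj)
  then have q: "q permutes {1..N}"
    by (rule bij_imp_permutes) (auto simp: q_def)
  then have inv: "inv q permutes {1..N}"
    by (rule permutes_inv)
  have "x (inv q j) < x (inv q i)" if "i \<in> {1..N}" "j \<in> {1..N}" "i < j" for i j
  proof -
    have mem: "inv q i \<in> {1..N}" "inv q j \<in> {1..N}"
      using that inv by (auto simp: permutes_in_image simp del: atLeastAtMost_iff)
    have eq: "q (inv q i) = i" "q (inv q j) = j"
      using q by (auto simp: permutes_inverses)
    have "inv q i \<noteq> inv q j"
      using eq that(3) by (metis less_irrefl)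
    then have "x (inv q i) \<noteq> x (inv q j)"
      using assms mem by (auto dest: inj_onD)
    moreover have "\<not> x (inv q i) < x (inv q j)"
      using q_less[OF mem(2,1)] eq that by auto
    ultimately show ?thesis
      by simp
  qed
  then have "position_ordered N (x \<circ> inv q)"
    by (simp add: position_ordered_def)
  with inv that show thesis
    by blast
qed

section \<open>Position-ordered form\<close>

text \<open>\<open>P i\<close> of the overview. The exponent carries no absolute value, so the
  factor relating neighbouring indices can be pulled out directly; on ordered positions it agrees
  with the original one. The same holds for \<open>rear_sum\<close>, which is
  \<open>Q i\<close>.\<close>

definition front_sum :: "(nat \<Rightarrow> real) \<Rightarrow> (nat \<Rightarrow> real) \<Rightarrow> nat \<Rightarrow> real" where
  "front_sum a x i = (\<Sum>j\<in>{1..<i}. a j * exp (x i - x j))"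

definition rear_sum :: "nat \<Rightarrow> (nat \<Rightarrow> real) \<Rightarrow> (nat \<Rightarrow> real) \<Rightarrow> nat \<Rightarrow> real" where
  "rear_sum N a x i = (\<Sum>j\<in>{i<..N}. a j * exp (x j - x i))"

text \<open>The coefficient of \<open>x i\<close> in the part of \<open>I_ordered\<close> that is
  linear in the positions.\<close>

definition alternating_sum :: "nat \<Rightarrow> (nat \<Rightarrow> real) \<Rightarrow> nat \<Rightarrow> real" where
  "alternating_sum N a i =
     (\<Sum>j\<in>{i<..N}. (-1) ^ (i + j) * (a j)\<^sup>2) - (\<Sum>j\<in>{1..<i}. (-1) ^ (j + i) * (a j)\<^sup>2)"

lemma position_ordered_inj: "position_ordered N x \<Longrightarrow> inj_on x {1..N}"
  unfolding position_ordered_def by (rule inj_onI) (metis less_irrefl linorder_neqE_nat)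

lemma position_ordered_distance:
  assumes "position_ordered N x" and "i \<in> {1..N}" and "j \<in> {1..N}" and "i < j"
  shows "\<bar>x i - x j\<bar> = x i - x j" "\<bar>x j - x i\<bar> = x i - x j"
    "sgn (x i - x j) = 1" "sgn (x j - x i) = -1"
proof -
  have "x j < x i"
    using assms unfolding position_ordered_def by blast
  then show "\<bar>x i - x j\<bar> = x i - x j" "\<bar>x j - x i\<bar> = x i - x j"
    "sgn (x i - x j) = 1" "sgn (x j - x i) = -1"
    by auto
qed

lemma sum_exp_ordered:
  assumes "position_ordered N x" and "i \<in> {1..N}"
  shows "(\<Sum>j\<in>{1..N} - {i}. a j * exp (- \<bar>x i - x j\<bar>)) = front_sum a x i + rear_sum N a x i"
proof -
  have "(\<Sum>j\<in>{1..<i}. a j * exp (- \<bar>x i - x j\<bar>)) = front_sum a x i"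
    unfolding front_sum_def
  proof (rule sum.cong[OF refl])
    fix j assume "j \<in> {1..<i}"
    with assms(2) have "j \<in> {1..N}" "j < i"
      by auto
    note dist = position_ordered_distance[OF assms(1) this(1) assms(2) this(2)]
    show "a j * exp (- \<bar>x i - x j\<bar>) = a j * exp (x i - x j)"
      by (simp only: dist minus_diff_eq mult_minus_left mult_1_left)
  qed
  moreover have "(\<Sum>j\<in>{i<..N}. a j * exp (- \<bar>x i - x j\<bar>)) = rear_sum N a x i"
    unfolding rear_sum_def
  proof (rule sum.cong[OF refl])
    fix j assume "j \<in> {i<..N}"
    with assms(2) have "j \<in> {1..N}" "i < j"
      by auto
    note dist = position_ordered_distance[OF assms(1) assms(2) this]
    show "a j * exp (- \<bar>x i - x j\<bar>) = a j * exp (x j - x i)"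
      by (simp only: dist minus_diff_eq mult_1_left)
  qed
  ultimately show ?thesis
    by (simp only: sum_remove_split[OF assms(2)])
qed

lemma sum_sgn_exp_ordered:
  assumes "position_ordered N x" and "i \<in> {1..N}"
  shows "(\<Sum>j\<in>{1..N} - {i}. sgn (x i - x j) * a j * exp (- \<bar>x i - x j\<bar>))
       = - front_sum a x i + rear_sum N a x i"
proof -
  have "(\<Sum>j\<in>{1..<i}. sgn (x i - x j) * a j * exp (- \<bar>x i - x j\<bar>))
      = (\<Sum>j\<in>{1..<i}. - (a j * exp (x i - x j)))"
  proof (rule sum.cong[OF refl])
    fix j assume "j \<in> {1..<i}"
    with assms(2) have "j \<in> {1..N}" "j < i"
      by auto
    note dist = position_ordered_distance[OF assms(1) this(1) assms(2) this(2)]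
    show "sgn (x i - x j) * a j * exp (- \<bar>x i - x j\<bar>) = - (a j * exp (x i - x j))"
      by (simp only: dist minus_diff_eq mult_minus_left mult_1_left)
  qed
  then have "(\<Sum>j\<in>{1..<i}. sgn (x i - x j) * a j * exp (- \<bar>x i - x j\<bar>)) = - front_sum a x i"
    by (simp only: front_sum_def sum_negf)
  moreover have "(\<Sum>j\<in>{i<..N}. sgn (x i - x j) * a j * exp (- \<bar>x i - x j\<bar>)) = rear_sum N a x i"
    unfolding rear_sum_def
  proof (rule sum.cong[OF refl])
    fix j assume "j \<in> {i<..N}"
    with assms(2) have "j \<in> {1..N}" "i < j"
      by auto
    note dist = position_ordered_distance[OF assms(1) assms(2) this]
    show "sgn (x i - x j) * a j * exp (- \<bar>x i - x j\<bar>) = a j * exp (x j - x i)"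
      by (simp only: dist minus_diff_eq mult_1_left)
  qed
  ultimately show ?thesis
    by (simp only: sum_remove_split[OF assms(2)])
qed

text \<open>With \<open>P\<close> and \<open>Q\<close> the front and rear sums, the two squares are
  those of \<open>P + Q\<close> and \<open>Q - P\<close>, and their difference is
  \<open>4 * P * Q\<close>.\<close>

lemma peakon_velocity_ordered:
  assumes "position_ordered N x" and "i \<in> {1..N}"
  shows "peakon_velocity N a x i =
     2/3 * (a i)\<^sup>2 + 2 * a i * (front_sum a x i + rear_sum N a x i)
     + 4 * (front_sum a x i * rear_sum N a x i)"
  unfolding peakon_velocity_squares[OF position_ordered_inj[OF assms(1)] assms(2)]
    sum_exp_ordered[OF assms, of a] sum_sgn_exp_ordered[OF assms, of a]
  by (simp add: power2_eq_square algebra_simps)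

lemma ordered_peakon_velocity_eq:
  assumes "position_ordered N x" and "i \<in> {1..N}"
  shows "ordered_peakon_velocity N a x i = peakon_velocity N a x i"
proof -
  \<comment> \<open>The pairs straddling \<open>i\<close> form a rectangle, and
    \<open>exp (- (x j - x k))\<close> factors through \<open>x i\<close>, so their sum is a
    product.\<close>
  have "{(j, k). j \<in> {1..N} \<and> k \<in> {1..N} \<and> j < i \<and> i < k} = {1..<i} \<times> {i<..N}"
    using assms(2) by auto
  then have "(\<Sum>(j, k)\<in>{(j, k). j \<in> {1..N} \<and> k \<in> {1..N} \<and> j < i \<and> i < k}.
              a j * a k * exp (- (x j - x k))) = front_sum a x i * rear_sum N a x i"
    unfolding front_sum_def rear_sum_def sum_product
    by (simp only: sum.cartesian_product) (simp add: exp_diff field_simps)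
  then show ?thesis
    by (simp only: ordered_peakon_velocity_def peakon_velocity_ordered[OF assms]
        sum_exp_ordered[OF assms])
qed

lemma sign_count_ordered:
  assumes "position_ordered N x" and "k \<in> {1..N}"
  shows "sign_count N x k = k - 1"
proof -
  have "x j > x k \<longleftrightarrow> j < k" if "j \<in> {1..N}" for j
    using assms that unfolding position_ordered_def by (metis less_asym linorder_neqE_nat less_irrefl)
  then have "{j \<in> {1..N}. sgn (x j - x k) = 1} = {1..<k}"
    using assms(2) by (auto simp: sgn_1_pos)
  then show ?thesis
    by (simp add: sign_count_def)
qed

text \<open>Free of \<open>sgn\<close> and absolute values, hence smooth in all variables and open
  to differentiation, unlike \<open>I_peakon\<close>.\<close>

definition I_ordered :: "nat \<Rightarrow> (nat \<Rightarrow> real) \<Rightarrow> (nat \<Rightarrow> real) \<Rightarrow> real" where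
  "I_ordered N a x = (\<Sum>(i, j)\<in>{(i, j). i \<in> {1..N} \<and> j \<in> {1..N} \<and> i < j}.
     3 * a i * a j * exp (- (x i - x j)) + (-1) ^ (i + j) * ((a j)\<^sup>2 * x i - (a i)\<^sup>2 * x j))"

lemma I_peakon_ordered:
  assumes "position_ordered N x"
  shows "I_peakon N a x = I_ordered N a x"
proof -
  \<comment> \<open>The counts are \<open>i - 1\<close> and \<open>j - 1\<close>; their sum falls
    short of \<open>i + j\<close> by two, so the parity is the same.\<close>
  have pow: "(-1) ^ (sign_count N x j + sign_count N x i) = ((-1) ^ (i + j) :: real)"
    if "i \<in> {1..N}" "j \<in> {1..N}" for i j
    using that unfolding sign_count_ordered[OF assms that(1)] sign_count_ordered[OF assms that(2)]
    by (cases i; cases j) (auto simp: power_add)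
  show ?thesis
    unfolding I_peakon_def I_ordered_def sum_neq_pairs[OF finite_atLeastAtMost]
  proof (intro sum.cong refl, elim CollectE case_prodE conjE, hypsubst, unfold prod.case)
    fix i j :: nat
    assume ij: "i \<in> {1..N}" "j \<in> {1..N}" "i < j"
    show "sgn (x i - x j) * (-1) ^ (sign_count N x j + sign_count N x i) * (a j)\<^sup>2 * x i
        + 3/2 * a i * a j * exp (- \<bar>x i - x j\<bar>)
        + (sgn (x j - x i) * (-1) ^ (sign_count N x i + sign_count N x j) * (a i)\<^sup>2 * x j
        + 3/2 * a j * a i * exp (- \<bar>x j - x i\<bar>))
        = 3 * a i * a j * exp (- (x i - x j)) + (-1) ^ (i + j) * ((a j)\<^sup>2 * x i - (a i)\<^sup>2 * x j)"
      unfolding pow[OF ij(1,2)] pow[OF ij(2,1)] position_ordered_distance[OF assms ij]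
      by (simp add: algebra_simps)
  qed
qed

section \<open>Conservation\<close>

lemma front_sum_Suc:
  assumes "1 \<le> i"
  shows "front_sum a x (Suc i) = exp (x (Suc i) - x i) * (front_sum a x i + a i)"
proof -
  have "front_sum a x (Suc i) = (\<Sum>j\<in>{1..<i}. a j * exp (x (Suc i) - x j)) + a i * exp (x (Suc i) - x i)"
    using assms by (simp add: front_sum_def)
  then show ?thesis
    by (simp add: front_sum_def sum_distrib_left distrib_left mult_exp_exp mult.left_commute)
qed

lemma rear_sum_Suc:
  assumes "i < N"
  shows "rear_sum N a x i = exp (x (Suc i) - x i) * (rear_sum N a x (Suc i) + a (Suc i))"
proof -
  have "{i<..N} = insert (Suc i) {Suc i<..N}"
    using assms by auto
  then have "rear_sum N a x i = (\<Sum>j\<in>{Suc i<..N}. a j * exp (x j - x i)) + a (Suc i) * exp (x (Suc i) - x i)"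
    by (simp add: rear_sum_def)
  then show ?thesis
    by (simp add: rear_sum_def sum_distrib_left distrib_left mult_exp_exp mult.left_commute)
qed

text \<open>Stepping from \<open>i\<close> to \<open>Suc i\<close> flips every sign, while
  \<open>(a (Suc i))\<^sup>2\<close> leaves the rear part and \<open>(a i)\<^sup>2\<close> enters
  the front part. This makes the coefficients of a common \<open>W i\<close> at neighbouring peakons
  fit for telescoping.\<close>

lemma alternating_sum_Suc:
  assumes "1 \<le> i" and "i < N"
  shows "alternating_sum N a (Suc i) + (a (Suc i))\<^sup>2 = (a i)\<^sup>2 - alternating_sum N a i"
proof -
  have "{i<..N} = insert (Suc i) {Suc i<..N}"
    using assms by auto
  then have "(\<Sum>j\<in>{i<..N}. (-1) ^ (i + j) * (a j)\<^sup>2)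
      = - (a (Suc i))\<^sup>2 - (\<Sum>j\<in>{Suc i<..N}. (-1) ^ (Suc i + j) * (a j)\<^sup>2)"
    by (simp add: sum_negf)
  moreover have "(\<Sum>j\<in>{1..<Suc i}. (-1) ^ (j + Suc i) * (a j)\<^sup>2)
      = - (a i)\<^sup>2 - (\<Sum>j\<in>{1..<i}. (-1) ^ (j + i) * (a j)\<^sup>2)"
    using assms by (simp add: sum_negf)
  ultimately show ?thesis
    by (simp add: alternating_sum_def)
qed

text \<open>The summand is symmetric in \<open>i\<close> and \<open>j\<close> but counted with
  opposite signs for \<open>j > i\<close> and \<open>j < i\<close>. It disposes of the product of
  the linear coefficients with the self-interaction \<open>2/3 * (a i)\<^sup>2\<close>.\<close>

lemma sum_alternating_sum:
  "(\<Sum>i\<in>{1..N}. alternating_sum N a i * (a i)\<^sup>2) = 0"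
proof -
  let ?f = "\<lambda>i j. (-1) ^ (i + j) * (a j)\<^sup>2 * (a i)\<^sup>2"
  have "(\<Sum>i\<in>{1..N}. \<Sum>j\<in>{i<..N}. ?f i j) = (\<Sum>i\<in>{1..N}. \<Sum>j\<in>{1..<i}. ?f j i)"
    by (simp only: sum_less_pairs_fst[symmetric] sum_less_pairs_snd[symmetric])
  moreover have "alternating_sum N a i * (a i)\<^sup>2 = (\<Sum>j\<in>{i<..N}. ?f i j) - (\<Sum>j\<in>{1..<i}. ?f j i)" for i
    unfolding alternating_sum_def left_diff_distrib sum_distrib_right by (simp add: mult_ac)
  ultimately show ?thesis
    by (simp add: sum_subtractf)
qed

text \<open>The first factor is the derivative of \<open>I_ordered\<close> with respect to
  \<open>x i\<close>. Reading \<open>W (i - 1)\<close> as \<open>P i * (Q i + a i)\<close>, one has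
  \<open>a i * (P i - Q i) = W (i - 1) - W i\<close>. The velocity contains the sum
  \<open>2 * W i + 2 * W (i - 1)\<close>, so the product yields a difference of squares.\<close>

lemma sum_gradient_velocity:
  assumes "position_ordered N x"
  shows "(\<Sum>i\<in>{1..N}. (alternating_sum N a i + 3 * a i * (front_sum a x i - rear_sum N a x i))
            * peakon_velocity N a x i) = 0"
proof -
  define P where "P = front_sum a x"
  define Q where "Q = rear_sum N a x"
  define c where "c = alternating_sum N a"
  define W where "W i = (P i + a i) * Q i" for i
  \<comment> \<open>Collects the terms with \<open>W i\<close> from the product at peakon
    \<open>i\<close>. The value 0 at index 0 is set by hand, since \<open>W 0\<close> would involve
    the meaningless \<open>a 0\<close>.\<close>
  define h where "h i = (if i = 0 then 0 else 2 * (c i - (a i)\<^sup>2) * W i - 6 * (W i)\<^sup>2)" for i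
  have W: "W i = P (Suc i) * (Q (Suc i) + a (Suc i))" if "1 \<le> i" "i < N" for i
    using that by (simp add: W_def P_def Q_def front_sum_Suc rear_sum_Suc)
  have c: "c (Suc i) + (a (Suc i))\<^sup>2 = (a i)\<^sup>2 - c i" if "1 \<le> i" "i < N" for i
    using alternating_sum_Suc that by (simp add: c_def)
  have "(c (Suc i) + 3 * a (Suc i) * (P (Suc i) - Q (Suc i))) * peakon_velocity N a x (Suc i)
      = 2/3 * (c (Suc i) * (a (Suc i))\<^sup>2) + (h (Suc i) - h i)" if "i < N" for i
  proof -
    define V where "V = P (Suc i) * (Q (Suc i) + a (Suc i))"
    \<comment> \<open>The same \<open>h i\<close> expressed through the data of peakon
      \<open>Suc i\<close>; for \<open>i = 0\<close> both sides vanish because \<open>P 1\<close> is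
      an empty sum.\<close>
    have "h i = - 2 * (c (Suc i) + (a (Suc i))\<^sup>2) * V - 6 * V\<^sup>2"
    proof (cases "i = 0")
      case True
      then show ?thesis
        by (simp add: h_def V_def P_def front_sum_def)
    next
      case False
      then have "W i = V" and "c i - (a i)\<^sup>2 = - (c (Suc i) + (a (Suc i))\<^sup>2)"
        using W[of i] c[of i] that by (simp_all add: V_def)
      with False show ?thesis
        by (simp add: h_def)
    qed
    moreover have "peakon_velocity N a x (Suc i) = 2/3 * (a (Suc i))\<^sup>2
        + 2 * a (Suc i) * (P (Suc i) + Q (Suc i)) + 4 * (P (Suc i) * Q (Suc i))"
      using peakon_velocity_ordered[OF assms, of "Suc i"] that by (simp add: P_def Q_def)
    moreover have "h (Suc i) = 2 * (c (Suc i) - (a (Suc i))\<^sup>2) * ((P (Suc i) + a (Suc i)) * Q (Suc i))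
        - 6 * ((P (Suc i) + a (Suc i)) * Q (Suc i))\<^sup>2"
      by (simp add: h_def W_def)
    ultimately show ?thesis
      by (simp only: V_def) (simp add: field_simps power2_eq_square)
  qed
  then have "(\<Sum>i<N. (c (Suc i) + 3 * a (Suc i) * (P (Suc i) - Q (Suc i))) * peakon_velocity N a x (Suc i))
      = (\<Sum>i<N. 2/3 * (c (Suc i) * (a (Suc i))\<^sup>2) + (h (Suc i) - h i))"
    by (intro sum.cong) auto
  also have "\<dots> = 2/3 * (\<Sum>i<N. c (Suc i) * (a (Suc i))\<^sup>2) + (h N - h 0)"
    by (simp only: sum.distrib sum_distrib_left sum_lessThan_telescope)
  also have "\<dots> = 0"
  proof -
    have "(\<Sum>i<N. c (Suc i) * (a (Suc i))\<^sup>2) = 0"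
      using sum_alternating_sum[of N a]
      by (simp add: c_def sum.atLeast1_atMost_eq)
    moreover have "Q N = 0"
      by (simp add: Q_def rear_sum_def)
    ultimately show ?thesis
      by (simp add: h_def W_def)
  qed
  finally show ?thesis
    by (simp add: sum.atLeast1_atMost_eq P_def Q_def c_def)
qed

section \<open>Differentiation along a solution\<close>

text \<open>The amplitudes are stationary at \<open>t\<close>, so only the chain rule in the
  positions contributes. Regrouping by peakon, \<open>i\<close> is the first member of its pairs
  with \<open>j > i\<close> and the second member of those with \<open>j < i\<close>.\<close>

lemma DERIV_I_ordered:
  assumes a: "\<And>i. i \<in> {1..N} \<Longrightarrow> (a i has_real_derivative 0) (at t within T)"
    and x: "\<And>i. i \<in> {1..N} \<Longrightarrow> (x i has_real_derivative v i) (at t within T)"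
  shows "((\<lambda>\<tau>. I_ordered N (\<lambda>i. a i \<tau>) (\<lambda>i. x i \<tau>)) has_real_derivative
    (\<Sum>i\<in>{1..N}. (alternating_sum N (\<lambda>i. a i t) i
       + 3 * a i t * (front_sum (\<lambda>i. a i t) (\<lambda>i. x i t) i - rear_sum N (\<lambda>i. a i t) (\<lambda>i. x i t) i))
       * v i)) (at t within T)"
proof -
  define b where "b = (\<lambda>i. a i t)"
  define y where "y = (\<lambda>i. x i t)"
  \<comment> \<open>\<open>X i j\<close> and \<open>Y i j\<close> are the partial derivatives of the
    term of the pair \<open>(i, j)\<close> with respect to \<open>x i\<close> and
    \<open>x j\<close>.\<close>
  define X where "X i j = (-1) ^ (i + j) * (b j)\<^sup>2 - 3 * b i * b j * exp (y j - y i)" for i j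
  define Y where "Y i j = 3 * b i * b j * exp (y j - y i) - (-1) ^ (i + j) * (b i)\<^sup>2" for i j
  let ?S = "{(i, j). i \<in> {1..N} \<and> j \<in> {1..N} \<and> i < j}"
  have deriv: "((\<lambda>\<tau>. case p of (i, j) \<Rightarrow> 3 * a i \<tau> * a j \<tau> * exp (- (x i \<tau> - x j \<tau>))
        + (-1) ^ (i + j) * ((a j \<tau>)\<^sup>2 * x i \<tau> - (a i \<tau>)\<^sup>2 * x j \<tau>)) has_real_derivative
        (case p of (i, j) \<Rightarrow> X i j * v i + Y i j * v j)) (at t within T)" if "p \<in> ?S" for p
  proof -
    from that obtain i j where p: "p = (i, j)" and ij: "i \<in> {1..N}" "j \<in> {1..N}"
      by auto
    note [derivative_intros] = a[OF ij(1)] a[OF ij(2)] x[OF ij(1)] x[OF ij(2)]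
    show ?thesis
      unfolding p prod.case X_def Y_def b_def y_def
      by (rule derivative_eq_intros refl)+ (simp add: algebra_simps)
  qed
  have "((\<lambda>\<tau>. I_ordered N (\<lambda>i. a i \<tau>) (\<lambda>i. x i \<tau>)) has_real_derivative
      (\<Sum>(i, j)\<in>?S. X i j * v i + Y i j * v j)) (at t within T)"
    unfolding I_ordered_def using deriv by (rule DERIV_sum)
  also have "(\<Sum>(i, j)\<in>?S. X i j * v i + Y i j * v j)
      = (\<Sum>(i, j)\<in>?S. X i j * v i) + (\<Sum>(i, j)\<in>?S. Y i j * v j)"
    by (simp add: case_prod_unfold sum.distrib)
  also have "\<dots> = (\<Sum>i\<in>{1..N}. ((\<Sum>j\<in>{i<..N}. X i j) + (\<Sum>j\<in>{1..<i}. Y j i)) * v i)"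
    unfolding sum_less_pairs_fst[of "\<lambda>i j. X i j * v i" N] sum_less_pairs_snd[of "\<lambda>i j. Y i j * v j" N]
    by (simp add: sum.distrib sum_distrib_right distrib_right)
  also have "\<dots> = (\<Sum>i\<in>{1..N}. (alternating_sum N b i
      + 3 * b i * (front_sum b y i - rear_sum N b y i)) * v i)"
  proof -
    have "(\<Sum>j\<in>{i<..N}. X i j) + (\<Sum>j\<in>{1..<i}. Y j i)
        = alternating_sum N b i + 3 * b i * (front_sum b y i - rear_sum N b y i)" for i
      by (simp add: X_def Y_def alternating_sum_def front_sum_def rear_sum_def sum_subtractf
          sum_distrib_left right_diff_distrib mult_ac)
    then show ?thesis
      by simp
  qed
  finally show ?thesis
    unfolding b_def y_def .
qed

text \<open>Finitely many strict inequalities form an open condition, so a labelling that sorts the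
  peakons at \<open>t\<close> still sorts them nearby.\<close>

lemma eventually_position_ordered:
  assumes "\<And>i. i \<in> {1..N} \<Longrightarrow> ((x i) \<longlongrightarrow> y i) F" and "position_ordered N y"
  shows "\<forall>\<^sub>F \<tau> in F. position_ordered N (\<lambda>i. x i \<tau>)"
proof -
  have "\<forall>\<^sub>F \<tau> in F. x j \<tau> < x i \<tau>" if "i \<in> {1..N}" "j \<in> {1..N}" "i < j" for i j
  proof -
    have "y j < y i"
      using assms(2) that by (simp add: position_ordered_def)
    then obtain c where "y j < c" "c < y i"
      using dense by blast
    with assms(1) that have "\<forall>\<^sub>F \<tau> in F. x j \<tau> < c" "\<forall>\<^sub>F \<tau> in F. c < x i \<tau>"
      by (auto intro: order_tendstoD simp del: atLeastAtMost_iff)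
    then show ?thesis
      by eventually_elim simp
  qed
  then have "\<forall>\<^sub>F \<tau> in F. \<forall>i\<in>{1..N}. \<forall>j\<in>{1..N}. i < j \<longrightarrow> x j \<tau> < x i \<tau>"
    by (intro eventually_ball_finite) (auto simp: eventually_ball_finite)
  then show ?thesis
    by (simp add: position_ordered_def)
qed

text \<open>Near a time without collisions a fixed relabelling turns \<open>I_peakon\<close> into
  the smooth \<open>I_ordered\<close>, whose derivative is the vanishing sum of
  \<open>sum_gradient_velocity\<close>.\<close>

lemma local_constant_of_motion_I_peakon: "local_constant_of_motion N (I_peakon N)"
  unfolding local_constant_of_motion_def
proof (intro allI impI ballI)
  fix T a x t
  assume sol: "peakon_solution N T a x" and t: "t \<in> T" and inj: "inj_on (\<lambda>i. x i t) {1..N}"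
  obtain p where p: "p permutes {1..N}" and ord: "position_ordered N ((\<lambda>i. x i t) \<circ> p)"
    using ex_ordering_permutation[OF inj] by blast
  have mem: "p i \<in> {1..N}" if "i \<in> {1..N}" for i
    using p that by (simp only: permutes_in_image)
  have eqs: "\<forall>i\<in>{1..N}. (a i has_real_derivative 0) (at t within T) \<and>
      (x i has_real_derivative peakon_velocity N (\<lambda>j. a j t) (\<lambda>j. x j t) i) (at t within T)"
    using sol t inj unfolding peakon_solution_def by blast
  have da: "(a (p i) has_real_derivative 0) (at t within T)"
    and dx: "(x (p i) has_real_derivative
      peakon_velocity N ((\<lambda>j. a j t) \<circ> p) ((\<lambda>j. x j t) \<circ> p) i) (at t within T)"
    if "i \<in> {1..N}" for i
    using bspec[OF eqs mem[OF that]] by (simp_all only: peakon_velocity_permute[OF p inj that])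
  have eq: "I_peakon N (\<lambda>i. a i \<tau>) (\<lambda>i. x i \<tau>) = I_ordered N (\<lambda>i. a (p i) \<tau>) (\<lambda>i. x (p i) \<tau>)"
    if "position_ordered N (\<lambda>i. x (p i) \<tau>)" for \<tau>
  proof -
    have "I_peakon N (\<lambda>i. a i \<tau>) (\<lambda>i. x i \<tau>)
        = I_peakon N ((\<lambda>i. a i \<tau>) \<circ> p) ((\<lambda>i. x i \<tau>) \<circ> p)"
      by (rule permutation_invariant_I_peakon[unfolded permutation_invariant_def, rule_format,
            OF p, symmetric])
    also have "\<dots> = I_ordered N (\<lambda>i. a (p i) \<tau>) (\<lambda>i. x (p i) \<tau>)"
      unfolding o_def using that by (rule I_peakon_ordered)
    finally show ?thesis .
  qed
  have "\<forall>\<^sub>F \<tau> in at t within T. position_ordered N (\<lambda>i. x (p i) \<tau>)"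
  proof (rule eventually_position_ordered)
    \<comment> \<open>Continuity at \<open>t\<close> comes from differentiability at
      \<open>t\<close> alone, as nothing is known about collision times beforehand.\<close>
    show "(x (p i) \<longlongrightarrow> ((\<lambda>i. x i t) \<circ> p) i) (at t within T)" if "i \<in> {1..N}" for i
      using DERIV_continuous[OF dx[OF that]] by (simp add: continuous_within)
  qed (fact ord)
  then have "\<forall>\<^sub>F \<tau> in at t within T. I_peakon N (\<lambda>i. a i \<tau>) (\<lambda>i. x i \<tau>)
      = I_ordered N (\<lambda>i. a (p i) \<tau>) (\<lambda>i. x (p i) \<tau>)"
    by eventually_elim (rule eq)
  moreover have "((\<lambda>\<tau>. I_ordered N (\<lambda>i. a (p i) \<tau>) (\<lambda>i. x (p i) \<tau>)) has_real_derivative 0) (at t within T)"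
    using sum_gradient_velocity[OF ord, of "(\<lambda>i. a i t) \<circ> p"]
      DERIV_I_ordered[where a = "\<lambda>i. a (p i)" and x = "\<lambda>i. x (p i)" and N = N, OF da dx]
    by (simp add: o_def)
  ultimately show "((\<lambda>\<tau>. I_peakon N (\<lambda>i. a i \<tau>) (\<lambda>i. x i \<tau>)) has_real_derivative 0) (at t within T)"
    using eq[of t] ord by (subst has_field_derivative_cong_eventually) (auto simp: o_def)
qed

section \<open>Odd numbers of peakons\<close>

text \<open>The pairs \<open>(i - 1, i)\<close> with \<open>i\<close> even tile the range from 1;
  for odd \<open>n\<close> the last index is left without a partner.\<close>

lemma sum_even_backward_differences:
  fixes x :: "nat \<Rightarrow> real"
  shows "(\<Sum>i\<in>{i \<in> {1..n}. even i}. x (i - 1) - x i)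
       = - (\<Sum>k\<in>{1..n}. (-1) ^ k * x k) - (if odd n then x n else 0)"
proof (induction n)
  case (Suc n)
  have "{i \<in> {1..Suc n}. even i} = (if odd n then insert (Suc n) else id) {i \<in> {1..n}. even i}"
    by (auto simp: le_Suc_eq)
  with Suc show ?case
    by auto
qed simp

text \<open>The pairs \<open>(i, i + 1)\<close> with \<open>i\<close> even tile the range from 2,
  which leaves out \<open>x 1\<close>; for even \<open>n\<close> the last pair reaches over to
  \<open>x (n + 1)\<close>.\<close>

lemma sum_even_forward_differences:
  fixes x :: "nat \<Rightarrow> real"
  shows "(\<Sum>i\<in>{i \<in> {1..n}. even i}. x i - x (i + 1))
       = (\<Sum>k\<in>{1..n}. (-1) ^ k * x k) + x 1 - (if even n then x (n + 1) else 0)"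
proof (induction n)
  case (Suc n)
  have "{i \<in> {1..Suc n}. even i} = (if odd n then insert (Suc n) else id) {i \<in> {1..n}. even i}"
    by (auto simp: le_Suc_eq)
  with Suc show ?case
    by auto
qed simp

text \<open>Both sides are linear in \<open>B j = (-1) ^ j * b j\<close>, and it suffices to compare
  the coefficients, which are alternating sums of positions on the left and sums of gaps on the
  right.\<close>

lemma alternating_part_odd:
  fixes x b :: "nat \<Rightarrow> real"
  assumes "odd N"
  shows "(\<Sum>(i, j)\<in>{(i, j). i \<in> {1..N} \<and> j \<in> {1..N} \<and> i < j}. (-1) ^ (i + j) * (b j * x i - b i * x j))
       = - (\<Sum>i\<in>{i \<in> {1..N}. even i}.
              (x (i - 1) - x i) * (\<Sum>j\<in>{i..N}. (-1) ^ j * b j)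
              + (x i - x (i + 1)) * (\<Sum>j\<in>{1..i}. (-1) ^ j * b j))"
proof -
  let ?E = "{i \<in> {1..N}. even i}"
  let ?S = "{(i, j). i \<in> {1..N} \<and> j \<in> {1..N} \<and> i < j}"
  define B where "B j = (-1) ^ j * b j" for j
  define z where "z k = (-1) ^ k * x k" for k
  have "(\<Sum>(i, j)\<in>?S. (-1) ^ (i + j) * (b j * x i - b i * x j))
      = (\<Sum>(i, j)\<in>?S. z i * B j) - (\<Sum>(i, j)\<in>?S. B i * z j)"
    unfolding sum_subtractf[symmetric] B_def z_def
    by (intro sum.cong) (auto simp: power_add algebra_simps)
  also have "\<dots> = (\<Sum>j\<in>{1..N}. B j * ((\<Sum>k\<in>{1..<j}. z k) - (\<Sum>k\<in>{j<..N}. z k)))"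
    unfolding sum_less_pairs_snd[of "\<lambda>i j. z i * B j" N] sum_less_pairs_fst[of "\<lambda>i j. B i * z j" N]
      sum_subtractf[symmetric]
    by (simp add: sum_distrib_left right_diff_distrib mult.commute)
  finally have lhs: "(\<Sum>(i, j)\<in>?S. (-1) ^ (i + j) * (b j * x i - b i * x j))
      = (\<Sum>j\<in>{1..N}. B j * ((\<Sum>k\<in>{1..<j}. z k) - (\<Sum>k\<in>{j<..N}. z k)))" .
  have "(\<Sum>i\<in>?E. (x (i - 1) - x i) * (\<Sum>j\<in>{i..N}. B j))
      = (\<Sum>i\<in>?E. \<Sum>j\<in>{j \<in> {1..N}. i \<le> j}. (x (i - 1) - x i) * B j)"
    unfolding sum_distrib_left by (intro sum.cong refl) auto
  also have "\<dots> = (\<Sum>j\<in>{1..N}. \<Sum>i\<in>{i \<in> ?E. i \<le> j}. (x (i - 1) - x i) * B j)"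
    by (rule sum.swap_restrict) auto
  finally have swap1: "(\<Sum>i\<in>?E. (x (i - 1) - x i) * (\<Sum>j\<in>{i..N}. B j))
      = (\<Sum>j\<in>{1..N}. B j * (\<Sum>i\<in>{i \<in> ?E. i \<le> j}. x (i - 1) - x i))"
    by (simp add: sum_distrib_left mult.commute)
  have "(\<Sum>i\<in>?E. (x i - x (i + 1)) * (\<Sum>j\<in>{1..i}. B j))
      = (\<Sum>i\<in>?E. \<Sum>j\<in>{j \<in> {1..N}. j \<le> i}. (x i - x (i + 1)) * B j)"
    unfolding sum_distrib_left by (intro sum.cong refl) auto
  also have "\<dots> = (\<Sum>j\<in>{1..N}. \<Sum>i\<in>{i \<in> ?E. j \<le> i}. (x i - x (i + 1)) * B j)"
    by (rule sum.swap_restrict) auto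
  finally have swap2: "(\<Sum>i\<in>?E. (x i - x (i + 1)) * (\<Sum>j\<in>{1..i}. B j))
      = (\<Sum>j\<in>{1..N}. B j * (\<Sum>i\<in>{i \<in> ?E. j \<le> i}. x i - x (i + 1)))"
    by (simp add: sum_distrib_left mult.commute)
  have coeff: "(\<Sum>k\<in>{1..<j}. z k) - (\<Sum>k\<in>{j<..N}. z k)
      = - ((\<Sum>i\<in>{i \<in> ?E. i \<le> j}. x (i - 1) - x i) + (\<Sum>i\<in>{i \<in> ?E. j \<le> i}. x i - x (i + 1)))"
    if j: "j \<in> {1..N}" for j
  proof -
    obtain m where m: "j = Suc m"
      using j by (cases j) auto
    \<comment> \<open>Handles both parities of \<open>j\<close> at once: \<open>w\<close> is what
      index \<open>j\<close> contributes to the backward sum, and \<open>w - z j\<close> is the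
      overhang of the forward sum up to \<open>m = j - 1\<close>.\<close>
    define w where "w = (if even j then x j else 0)"
    have zj: "z j + (if odd j then x j else 0) = w" "w - z j = (if even m then x (m + 1) else 0)"
      using m by (simp_all add: w_def z_def)
    have zm: "(\<Sum>k\<in>{1..j}. z k) = (\<Sum>k\<in>{1..m}. z k) + z j"
      using m by simp
    have upto_j: "{i \<in> ?E. i \<le> j} = {i \<in> {1..j}. even i}"
      using j by auto
    have bwd: "(\<Sum>i\<in>{i \<in> ?E. i \<le> j}. x (i - 1) - x i) = - (\<Sum>k\<in>{1..m}. z k) - w"
      using sum_even_backward_differences[of x j] zj(1) zm
      unfolding upto_j z_def[symmetric] by linarith
    have fwd: "(\<Sum>i\<in>{i \<in> {1..m}. even i}. x i - x (i + 1)) = (\<Sum>k\<in>{1..m}. z k) + x 1 - (w - z j)"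
      unfolding zj(2) unfolding z_def by (rule sum_even_forward_differences)
    \<comment> \<open>The forward differences from \<open>j\<close> on are obtained as the total
      minus an initial segment, to which the closed form applies.\<close>
    have "?E = {i \<in> {1..m}. even i} \<union> {i \<in> ?E. j \<le> i}"
      using j m by auto
    then have "(\<Sum>i\<in>?E. x i - x (i + 1))
        = (\<Sum>i\<in>{i \<in> {1..m}. even i} \<union> {i \<in> ?E. j \<le> i}. x i - x (i + 1))"
      by (rule arg_cong)
    also have "\<dots> = (\<Sum>i\<in>{i \<in> {1..m}. even i}. x i - x (i + 1)) + (\<Sum>i\<in>{i \<in> ?E. j \<le> i}. x i - x (i + 1))"
      by (rule sum.union_disjoint) (use m in auto)
    finally have split_at_j: "(\<Sum>i\<in>?E. x i - x (i + 1))
        = (\<Sum>i\<in>{i \<in> {1..m}. even i}. x i - x (i + 1)) + (\<Sum>i\<in>{i \<in> ?E. j \<le> i}. x i - x (i + 1))" .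
    \<comment> \<open>Oddness of \<open>N\<close> is decisive: it removes the overhang
      \<open>x (N + 1)\<close>.\<close>
    have "(\<Sum>i\<in>?E. x i - x (i + 1)) = (\<Sum>k\<in>{1..N}. z k) + x 1"
      using sum_even_forward_differences[of x N] assms by (simp add: z_def)
    moreover have "(\<Sum>k\<in>{1..N}. z k) = z j + (\<Sum>k\<in>{1..N} - {j}. z k)"
      by (rule sum.remove) (use j in auto)
    moreover have "(\<Sum>k\<in>{1..N} - {j}. z k) = (\<Sum>k\<in>{1..<j}. z k) + (\<Sum>k\<in>{j<..N}. z k)"
      by (rule sum_remove_split) fact
    moreover have "{1..<j} = {1..m}"
      using m by auto
    ultimately show ?thesis
      using bwd fwd split_at_j by simp
  qed
  have "(\<Sum>j\<in>{1..N}. B j * ((\<Sum>k\<in>{1..<j}. z k) - (\<Sum>k\<in>{j<..N}. z k)))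
      = (\<Sum>j\<in>{1..N}. - (B j * (\<Sum>i\<in>{i \<in> ?E. i \<le> j}. x (i - 1) - x i)
          + B j * (\<Sum>i\<in>{i \<in> ?E. j \<le> i}. x i - x (i + 1))))"
    by (rule sum.cong[OF refl]) (simp only: coeff mult_minus_right distrib_left)
  then show ?thesis
    unfolding lhs B_def[symmetric] by (simp only: sum.distrib swap1 swap2 sum_negf)
qed

lemma I_ordered_odd:
  assumes "odd N"
  shows "I_ordered N a x =
    (\<Sum>(i, j)\<in>{(i, j). i \<in> {1..N} \<and> j \<in> {1..N} \<and> i < j}. 3 * a i * a j * exp (- (x i - x j)))
    - (\<Sum>i\<in>{i \<in> {1..N}. even i}.
         (x (i - 1) - x i) * (\<Sum>j\<in>{i..N}. (-1) ^ j * (a j)\<^sup>2)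
         + (x i - x (i + 1)) * (\<Sum>j\<in>{1..i}. (-1) ^ j * (a j)\<^sup>2))"
  using alternating_part_odd[OF assms, of "\<lambda>j. (a j)\<^sup>2" x]
  by (simp add: I_ordered_def case_prod_unfold sum.distrib)

text \<open>A shift keeps the order, so the same permutation sorts both configurations; the odd form
  of \<open>I_ordered\<close> then contains the positions only through differences.\<close>

lemma shift_invariant_I_peakon:
  assumes "odd N"
  shows "shift_invariant N (I_peakon N)"
  unfolding shift_invariant_def
proof (intro allI impI)
  fix a x :: "nat \<Rightarrow> real" and \<epsilon> :: real
  assume "inj_on x {1..N}"
  then obtain p where p: "p permutes {1..N}" and ord: "position_ordered N (x \<circ> p)"
    using ex_ordering_permutation by blast
  have perm: "I_peakon N (a \<circ> p) (y \<circ> p) = I_peakon N a y" for y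
    using permutation_invariant_I_peakon p by (simp add: permutation_invariant_def)
  have ord': "position_ordered N ((\<lambda>i. x i + \<epsilon>) \<circ> p)"
    using ord by (simp add: position_ordered_def)
  have "I_ordered N (a \<circ> p) ((\<lambda>i. x i + \<epsilon>) \<circ> p) = I_ordered N (a \<circ> p) (x \<circ> p)"
    by (simp add: I_ordered_odd[OF assms])
  then show "I_peakon N a (\<lambda>i. x i + \<epsilon>) = I_peakon N a x"
    using I_peakon_ordered[OF ord, of "a \<circ> p"] I_peakon_ordered[OF ord', of "a \<circ> p"]
      perm[of x] perm[of "\<lambda>i. x i + \<epsilon>"] by metis
qed

theorem theorem1:
  fixes N :: nat
  assumes "2 \<le> N"
  shows "permutation_invariant N (I_peakon N) \<and>
         local_constant_of_motion N (I_peakon N) \<and>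
         (odd N \<longrightarrow> shift_invariant N (I_peakon N)) \<and>
         (\<forall>a x. position_ordered N x \<longrightarrow>
            (\<forall>i\<in>{1..N}. peakon_velocity N a x i = ordered_peakon_velocity N a x i) \<and>
            I_peakon N a x =
              (\<Sum>(i, j)\<in>{(i, j). i \<in> {1..N} \<and> j \<in> {1..N} \<and> i < j}.
                 3 * a i * a j * exp (- (x i - x j))
                 + (-1) ^ (i + j) * ((a j)\<^sup>2 * x i - (a i)\<^sup>2 * x j)) \<and>
            (odd N \<longrightarrow>
              I_peakon N a x =
                (\<Sum>(i, j)\<in>{(i, j). i \<in> {1..N} \<and> j \<in> {1..N} \<and> i < j}.
                   3 * a i * a j * exp (- (x i - x j)))
                - (\<Sum>i\<in>{i \<in> {1..N}. even i}.
                     (x (i - 1) - x i) * (\<Sum>j\<in>{i..N}. (-1) ^ j * (a j)\<^sup>2)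
                     + (x i - x (i + 1)) * (\<Sum>j\<in>{1..i}. (-1) ^ j * (a j)\<^sup>2))))"
  using permutation_invariant_I_peakon local_constant_of_motion_I_peakon shift_invariant_I_peakon
  unfolding I_ordered_def[symmetric]
  by (simp add: ordered_peakon_velocity_eq I_peakon_ordered I_ordered_odd del: atLeastAtMost_iff One_nat_def)

end
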